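(* Let $\beta$ be a real number, let $G$ be a graph with $n$ vertices and $m\ge1$ edges, let $\gamma_1,\dots,\gamma_n$ be the eigenvalues of its general Randić matrix $\mathbf{R}_\beta(G)$, and let $I_{R_\beta}^1(G)$, $I_\alpha^2(G)$, $I_\alpha^3(G)$ be the generalized graph entropies formed from $\gamma_1,\dots,\gamma_n$. Then for every real $\alpha\ne1$: (i) $I_{R_\beta}^1(G)=1-\frac{2}{RE_\beta^2(G)}R_{2\beta}(G)$; (ii) $I_\alpha^2(G)=\frac{1}{1-\alpha}\log\frac{M_\alpha^*}{RE_\beta^\alpha(G)}$; (iii) $I_\alpha^3(G)=\frac{1}{2^{1-\alpha}-1}\left(\frac{M_\alpha^*}{RE_\beta^\alpha(G)}-1\right)$, where $RE_\beta(G)$ is the general Randić energy of $G$, $RE_\beta^\alpha(G)=(RE_\beta(G))^\alpha$, $R_{2\beta}(G)$ is the general Randić index of $G$ with exponent $2\beta$, and $M_\alpha^*=\sum_{i=1}^n|\gamma_i|^\alpha$.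
   Context: Graphs are finite and simple, with vertices $v_1,\dots,v_n$ of degrees $d_1,\dots,d_n$. The general Randić matrix $\mathbf{R}_\beta(G)=[r_{ij}]$ has $r_{ij}=(d_id_j)^\beta$ if $v_i$ and $v_j$ are adjacent, and $r_{ij}=0$ otherwise (i.e. $\mathbf{R}_\beta(G)=D(G)^\beta A(G)D(G)^\beta$ with $D(G)$ the degree matrix and $A(G)$ the adjacency matrix). The general Randić energy is $RE_\beta(G)=\sum_{i=1}^n|\gamma_i|$. The general Randić index with exponent $t$ is the number $R_t(G)=\sum_{i\sim j}(d_id_j)^t$, the sum over all edges $v_iv_j$ (each counted once). For numbers $\mu_1,\dots,\mu_n$ (listed with multiplicity) with $\sum_j|\mu_j|\neq 0$, put $p_i=|\mu_i|/\sum_{j=1}^n|\mu_j|$. The generalized graph entropies formed from $\mu_1,\dots,\mu_n$ are $I^1=\sum_{i=1}^n p_i(1-p_i)$, $\quad I^2_\alpha=\frac{1}{1-\alpha}\log\left(\sum_{i=1}^n p_i^\alpha\right)$, $\quad I^3_\alpha=\frac{\sum_{i=1}^n p_i^\alpha-1}{2^{1-\alpha}-1}$ for $\alpha\ne1$ (real $\alpha$ for which the occurring powers are defined). Here $\log$ is the logarithm to one fixed base greater than $1$. The subscript on $I^1$ names the matrix used. *)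

theory Defs
  imports Complex_Main "HOL-Library.Multiset" "Jordan_Normal_Form.Char_Poly"
begin

definition simple_graph :: "'a set \<Rightarrow> 'a set set \<Rightarrow> bool" where
  "simple_graph V E \<longleftrightarrow> finite V \<and> (\<forall>e\<in>E. e \<subseteq> V \<and> card e = 2)"

definition vdegree :: "'a set set \<Rightarrow> 'a \<Rightarrow> nat" where
  "vdegree E v = card {e \<in> E. v \<in> e}"

text \<open>The list \<open>vs\<close> enumerates the vertices. On the diagonal the entry is 0,
  because a singleton is never an edge of a simple graph.\<close>

definition randic_matrix :: "real \<Rightarrow> 'a list \<Rightarrow> 'a set set \<Rightarrow> real mat" where
  "randic_matrix \<beta> vs E = mat (length vs) (length vs)
     (\<lambda>(i, j). if {vs ! i, vs ! j} \<in> E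
               then (real (vdegree E (vs ! i)) * real (vdegree E (vs ! j))) powr \<beta>
               else 0)"

text \<open>The eigenvalues of a square matrix, listed with algebraic multiplicity.\<close>

definition eigenvalues_mset :: "'a :: idom mat \<Rightarrow> 'a multiset" where
  "eigenvalues_mset A = proots (char_poly A)"

definition randic_energy :: "real \<Rightarrow> 'a list \<Rightarrow> 'a set set \<Rightarrow> real" where
  "randic_energy \<beta> vs E = (\<Sum>x\<in>#eigenvalues_mset (randic_matrix \<beta> vs E). \<bar>x\<bar>)"

text \<open>The factor \<open>\<Prod>v\<in>e\<close> ranges over the two ends of \<open>e\<close>, so it is the product of their degrees.\<close>

definition randic_index :: "real \<Rightarrow> 'a set set \<Rightarrow> real" where
  "randic_index t E = (\<Sum>e\<in>E. (\<Prod>v\<in>e. real (vdegree E v)) powr t)"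

text \<open>
  A finite family of numbers, listed with multiplicity, is a multiset \<open>M\<close>; its member \<open>x\<close>
  gets the weight \<open>p = \<bar>x\<bar> / (\<Sum>y\<in>#M. \<bar>y\<bar>)\<close>. Real powers are \<open>powr\<close>, so
  \<open>0 powr \<alpha> = 0\<close> also for the exponents \<open>\<alpha> \<le> 0\<close>. The base of the logarithm is \<open>b\<close>.
\<close>

definition entropy_weight :: "real multiset \<Rightarrow> real \<Rightarrow> real" where
  "entropy_weight M x = \<bar>x\<bar> / (\<Sum>y\<in>#M. \<bar>y\<bar>)"

definition entropy1 :: "real multiset \<Rightarrow> real" where
  "entropy1 M = (\<Sum>x\<in>#M. entropy_weight M x * (1 - entropy_weight M x))"

definition entropy2 :: "real \<Rightarrow> real \<Rightarrow> real multiset \<Rightarrow> real" where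
  "entropy2 b \<alpha> M = 1 / (1 - \<alpha>) * log b (\<Sum>x\<in>#M. entropy_weight M x powr \<alpha>)"

definition entropy3 :: "real \<Rightarrow> real multiset \<Rightarrow> real" where
  "entropy3 \<alpha> M = ((\<Sum>x\<in>#M. entropy_weight M x powr \<alpha>) - 1) / (2 powr (1 - \<alpha>) - 1)"

definition abs_moment :: "real \<Rightarrow> real multiset \<Rightarrow> real" where
  "abs_moment \<alpha> M = (\<Sum>x\<in>#M. \<bar>x\<bar> powr \<alpha>)"

end

theory Submission
  imports Defs "Jordan_Normal_Form.Schur_Decomposition"
begin

text \<open>
  Parts (ii) and (iii) only rewrite the weights: since the energy
  \<open>S = (\<Sum>x\<in>#\<gamma>. \<bar>x\<bar>)\<close> does not depend on \<open>x\<close>, it can be pulled out of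
  \<open>\<Sum>x\<in>#\<gamma>. (\<bar>x\<bar> / S) powr \<alpha>\<close> as the factor \<open>1 / S powr \<alpha>\<close>.

  Part (i) carries the content. Expanding \<open>\<Sum>p (1 - p)\<close> gives \<open>1 - (\<Sum>x\<^sup>2) / S\<^sup>2\<close>, so what
  is needed is \<open>\<Sum>x\<^sup>2 = 2 R\<^bsub>2\<beta>\<^esub>(G)\<close>, together with \<open>S \<noteq> 0\<close>. The latter follows from the former:
  the index of a graph with an edge is positive, so some eigenvalue is nonzero.

  The identity \<open>\<Sum>x\<^sup>2 = 2 R\<^bsub>2\<beta>\<^esub>(G)\<close> is a computation of the trace of the square of the matrix in
  two ways. Counted by entries, it is \<open>\<Sum>\<^sub>i\<^sub>j r\<^sub>i\<^sub>j\<^sup>2\<close>, in which each edge appears once for either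
  order of its ends (\<open>sum_over_adjacent_pairs\<close>). Counted by eigenvalues, it is the sum of
  their squares, since the trace is invariant under similarity and a matrix whose
  characteristic polynomial splits is similar to a triangular one (\<open>trace_square_eigenvalues\<close>).
  The eigenvalues here are the roots found in the reals, so the argument needs all roots to be real;
  this is the spectral fact about symmetric matrices in \<open>symmetric_char_poly_splits\<close>.
\<close>

section \<open>The characteristic polynomial of a real symmetric matrix\<close>

text \<open>
  The classical argument: for \<open>A v = \<lambda> v\<close>, moving \<open>A\<close> across the Hermitian product
  gives \<open>\<lambda> \<langle>v, v\<rangle> = \<langle>A v, v\<rangle> = \<langle>v, A v\<rangle> = \<lambda>\<^sup>* \<langle>v, v\<rangle>\<close>, where \<open>\<langle>v, v\<rangle> \<noteq> 0\<close>.
\<close>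

lemma symmetric_eigenvalue_real:
  fixes A :: "real mat" and ev :: complex
  assumes A: "A \<in> carrier_mat n n" and sym: "transpose_mat A = A"
    and ev: "eigenvalue (map_mat of_real A) ev"
  shows "ev \<in> \<real>"
proof -
  let ?C = "map_mat complex_of_real A"
  have C: "?C \<in> carrier_mat n n" using A by simp
  have symC: "transpose_mat ?C = ?C" using sym by (metis map_mat_transpose)
  obtain v where v: "v \<in> carrier_vec n" "v \<noteq> 0\<^sub>v n" and eq: "?C *\<^sub>v v = ev \<cdot>\<^sub>v v"
    using ev C unfolding eigenvalue_def eigenvector_def by auto
  have cv: "conjugate v \<in> carrier_vec n" using v by simp
  have conj_eq: "?C *\<^sub>v conjugate v = conjugate (?C *\<^sub>v v)"
  proof (rule eq_vecI)
    fix i assume "i < dim_vec (conjugate (?C *\<^sub>v v))"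
    then have i: "i < n" using A by simp
    have "conjugate (row ?C i) = row ?C i"
      using i A by (intro eq_vecI) auto
    moreover have "conjugate (row ?C i \<bullet> v) = conjugate (row ?C i) \<bullet> conjugate v"
      by (rule conjugate_sprod_vec[of _ n]) (use i C v in auto)
    ultimately show "(?C *\<^sub>v conjugate v) $ i = conjugate (?C *\<^sub>v v) $ i"
      using i A by simp
  qed (use A in simp)
  have "ev * (v \<bullet>c v) = (?C *\<^sub>v v) \<bullet>c v" using eq v by simp
  also have "\<dots> = (transpose_mat ?C *\<^sub>v v) \<bullet>c v" using symC by simp
  also have "\<dots> = v \<bullet> (?C *\<^sub>v conjugate v)"
    by (rule transpose_vec_mult_scalar[OF C cv v(1)])
  also have "\<dots> = cnj ev * (v \<bullet>c v)"
    using v by (simp add: conj_eq eq conjugate_smult_vec)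
  finally have "ev = cnj ev" using v by simp
  then show ?thesis by (metis Reals_cnj_iff)
qed

text \<open>
  Over the complex numbers the polynomial factors, and the roots are real; so the factorization
  is the image of a real one, and comparing coefficients carries it back to the reals.
\<close>

lemma symmetric_char_poly_splits:
  fixes A :: "real mat"
  assumes A: "A \<in> carrier_mat n n" and sym: "transpose_mat A = A"
  shows "\<exists>as. char_poly A = (\<Prod>a\<leftarrow>as. [:- a, 1:])"
proof -
  let ?C = "map_mat complex_of_real A"
  interpret h: map_poly_inj_idom_hom complex_of_real ..
  have C: "?C \<in> carrier_mat n n" using A by simp
  obtain cs where cs: "char_poly ?C = (\<Prod>c\<leftarrow>cs. [:- c, 1:])"
    using char_poly_factorized[OF C] by blast
  have "c \<in> \<real>" if "c \<in> set cs" for c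
  proof -
    have "poly (char_poly ?C) c = 0"
      unfolding cs using that by (intro linear_poly_root)
    then show ?thesis
      using symmetric_eigenvalue_real[OF A sym] eigenvalue_root_char_poly[OF C] by blast
  qed
  then have "map (\<lambda>c. [:- c, 1:]) cs = map (\<lambda>a. [:- complex_of_real a, 1:]) (map Re cs)"
    by (auto simp: of_real_Re)
  then have "map_poly of_real (char_poly A) = (\<Prod>a\<leftarrow>map Re cs. [:- complex_of_real a, 1:])"
    using cs of_real_hom.char_poly_hom[OF A, where ?'a = complex] by metis
  also have "\<dots> = map_poly of_real (\<Prod>a\<leftarrow>map Re cs. [:- a, 1:])"
    by (simp add: h.hom_prod_list o_def)
  finally show ?thesis by (blast dest: h.injectivity)
qed

section \<open>The trace of the square\<close>

definition trace_mat :: "'a :: comm_ring_1 mat \<Rightarrow> 'a" where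
  "trace_mat A = (\<Sum>i<dim_row A. A $$ (i, i))"

lemma trace_mat_mult:
  assumes "A \<in> carrier_mat n n" "B \<in> carrier_mat n n"
  shows "trace_mat (A * B) = (\<Sum>i<n. \<Sum>j<n. A $$ (i, j) * B $$ (j, i))"
  using assms unfolding trace_mat_def
  by (auto simp: scalar_prod_def atLeast0LessThan intro!: sum.cong)

lemma trace_mat_mult_commute:
  assumes "A \<in> carrier_mat n n" "B \<in> carrier_mat n n"
  shows "trace_mat (A * B) = trace_mat (B * A)"
  unfolding trace_mat_mult[OF assms] trace_mat_mult[OF assms(2,1)]
  by (subst sum.swap) (simp add: mult.commute)

lemma trace_square_similar:
  assumes "similar_mat A B"
  shows "trace_mat (A * A) = trace_mat (B * B)"
proof -
  obtain n P Q where c: "A \<in> carrier_mat n n" "B \<in> carrier_mat n n"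
      "P \<in> carrier_mat n n" "Q \<in> carrier_mat n n"
    and QP: "Q * P = 1\<^sub>m n" and A: "A = P * B * Q"
    using similar_matD[OF assms] by auto
  have "A * A = P * B * ((Q * P) * (B * Q))"
    unfolding A using c by (simp add: assoc_mult_mat[of _ n n _ n _ n])
  also have "\<dots> = P * (B * B * Q)"
    unfolding QP using c by (simp add: assoc_mult_mat[of _ n n _ n _ n])
  finally have "trace_mat (A * A) = trace_mat (P * (B * B * Q))" by simp
  also have "\<dots> = trace_mat (B * B * Q * P)"
    by (rule trace_mat_mult_commute) (use c in auto)
  also have "B * B * Q * P = B * B"
    using c QP by (simp add: assoc_mult_mat[of _ n n _ n _ n])
  finally show ?thesis .
qed

lemma trace_square_upper_triangular:
  assumes B: "B \<in> carrier_mat n n" and ut: "upper_triangular B"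
  shows "trace_mat (B * B) = (\<Sum>x\<leftarrow>diag_mat B. x\<^sup>2)"
proof -
  have "B $$ (i, j) * B $$ (j, i) = (if j = i then (B $$ (i, i))\<^sup>2 else 0)"
    if "i < n" "j < n" for i j
    using that B upper_triangularD[OF ut, of i j] upper_triangularD[OF ut, of j i]
    by (cases i j rule: linorder_cases) (auto simp: power2_eq_square)
  then have "trace_mat (B * B) = (\<Sum>i<n. (B $$ (i, i))\<^sup>2)"
    by (simp add: trace_mat_mult[OF B B])
  also have "\<dots> = (\<Sum>x\<leftarrow>diag_mat B. x\<^sup>2)"
    using B by (simp add: diag_mat_def o_def interv_sum_list_conv_sum_set_nat atLeast0LessThan)
  finally show ?thesis .
qed

lemma proots_linear_factors: "proots (\<Prod>a\<leftarrow>as. [:- a, 1:]) = mset (as :: 'a :: idom list)"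
proof (induction as)
  case (Cons a as)
  have "(\<Prod>a\<leftarrow>as. [:- a, 1:]) \<noteq> 0" by (auto simp: prod_list_zero_iff)
  with Cons show ?case by (simp add: proots_mult del: mult_pCons_left)
qed simp

text \<open>
  Symmetry makes all roots real. Otherwise a pair of non-real roots would contribute to the
  trace but be missing from the multiset, which collects the real roots only.
\<close>

lemma trace_square_eigenvalues:
  fixes A :: "real mat"
  assumes A: "A \<in> carrier_mat n n" and sym: "transpose_mat A = A"
  shows "trace_mat (A * A) = (\<Sum>x\<in>#eigenvalues_mset A. x\<^sup>2)"
proof -
  obtain as where as: "char_poly A = (\<Prod>a\<leftarrow>as. [:- a, 1:])"
    using symmetric_char_poly_splits[OF assms] by blast
  obtain B where B: "B \<in> carrier_mat n n" "upper_triangular B" "similar_mat A B"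
    using schur_decomposition_exists[OF A as] by blast
  have "char_poly A = (\<Prod>a\<leftarrow>diag_mat B. [:- a, 1:])"
    using char_poly_similar[OF B(3)] char_poly_upper_triangular[OF B(1,2)] by simp
  then have "eigenvalues_mset A = mset (diag_mat B)"
    by (simp add: eigenvalues_mset_def proots_linear_factors)
  moreover have "trace_mat (A * A) = (\<Sum>x\<leftarrow>diag_mat B. x\<^sup>2)"
    using trace_square_similar[OF B(3)] trace_square_upper_triangular[OF B(1,2)] by simp
  ultimately show ?thesis by (simp flip: sum_mset_sum_list)
qed

section \<open>The general Randic matrix and index\<close>

lemma randic_matrix_carrier: "randic_matrix \<beta> vs E \<in> carrier_mat (length vs) (length vs)"
  by (simp add: randic_matrix_def)

lemma randic_matrix_symmetric: "transpose_mat (randic_matrix \<beta> vs E) = randic_matrix \<beta> vs E"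
  by (rule eq_matI) (auto simp: randic_matrix_def insert_commute mult.commute)

text \<open>Every edge is hit by exactly two ordered pairs, because its two ends are distinct.\<close>

lemma sum_over_adjacent_pairs:
  fixes g :: "'a set \<Rightarrow> 'b :: comm_semiring_1"
  assumes graph: "simple_graph V E"
  shows "(\<Sum>u\<in>V. \<Sum>v\<in>V. if {u, v} \<in> E then g {u, v} else 0) = 2 * (\<Sum>e\<in>E. g e)"
proof -
  have V: "finite V" and E: "\<And>e. e \<in> E \<Longrightarrow> e \<subseteq> V \<and> card e = 2"
    using graph by (auto simp: simple_graph_def)
  have "E \<subseteq> Pow V" using E by blast
  then have finE: "finite E" using V by (meson finite_Pow_iff finite_subset)
  define P where "P = {p \<in> V \<times> V. {fst p, snd p} \<in> E}"
  have finP: "finite P" using V by (simp add: P_def)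
  have "(\<Sum>u\<in>V. \<Sum>v\<in>V. if {u, v} \<in> E then g {u, v} else 0)
      = (\<Sum>p\<in>V \<times> V. if {fst p, snd p} \<in> E then g {fst p, snd p} else 0)"
    unfolding sum.cartesian_product by (simp add: case_prod_beta)
  also have "\<dots> = (\<Sum>p\<in>P. g {fst p, snd p})"
    using V by (simp add: P_def sum.inter_filter)
  also have "\<dots> = (\<Sum>e\<in>E. \<Sum>p\<in>{p \<in> P. {fst p, snd p} = e}. g {fst p, snd p})"
    using finP finE by (intro sum.group[symmetric]) (auto simp: P_def)
  also have "\<dots> = (\<Sum>e\<in>E. 2 * g e)"
  proof (rule sum.cong[OF refl])
    fix e assume e: "e \<in> E"
    then obtain a b where ab: "e = {a, b}" "a \<noteq> b" using E card_2_iff by metis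
    have "{p \<in> P. {fst p, snd p} = e} = {(a, b), (b, a)}"
    proof (rule Set.set_eqI)
      fix p :: "'a \<times> 'a"
      obtain u v where p: "p = (u, v)" by fastforce
      have "a \<in> V" "b \<in> V" using E[OF e] ab(1) by auto
      then have "p \<in> P \<longleftrightarrow> {u, v} \<in> E" if "{u, v} = e"
        using that ab(1) unfolding p P_def by (simp add: doubleton_eq_iff) blast
      then have "p \<in> {p \<in> P. {fst p, snd p} = e} \<longleftrightarrow> {u, v} = {a, b}"
        using e ab(1) unfolding p by auto
      then show "p \<in> {p \<in> P. {fst p, snd p} = e} \<longleftrightarrow> p \<in> {(a, b), (b, a)}"
        unfolding doubleton_eq_iff p by simp
    qed
    then show "(\<Sum>p\<in>{p \<in> P. {fst p, snd p} = e}. g {fst p, snd p}) = 2 * g e"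
      using ab by (simp add: insert_commute mult_2)
  qed
  finally show ?thesis by (simp add: sum_distrib_left)
qed

lemma trace_square_randic_matrix:
  assumes graph: "simple_graph V E" and vs: "distinct vs" "set vs = V"
  shows "trace_mat (randic_matrix \<beta> vs E * randic_matrix \<beta> vs E) = 2 * randic_index (2 * \<beta>) E"
proof -
  let ?d = "\<lambda>v. real (vdegree E v)"
  let ?r = "\<lambda>u v. if {u, v} \<in> E then (\<Prod>w\<in>{u, v}. ?d w) powr (2 * \<beta>) else 0"
  let ?R = "randic_matrix \<beta> vs E" and ?n = "length vs"
  have entry: "?R $$ (i, j) * ?R $$ (j, i) = ?r (vs ! i) (vs ! j)" if "i < ?n" "j < ?n" for i j
  proof (cases "{vs ! i, vs ! j} \<in> E")
    case True
    then have "card {vs ! i, vs ! j} = 2" using graph by (auto simp: simple_graph_def)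
    \<comment> \<open>Without this, the product over the set of ends would be a single degree.\<close>
    then have "vs ! i \<noteq> vs ! j" by auto
    with True that show ?thesis
      by (simp add: randic_matrix_def insert_commute mult.commute flip: powr_add)
  next
    case False
    with that show ?thesis by (simp add: randic_matrix_def insert_commute)
  qed
  have enum: "(\<Sum>i<?n. f (vs ! i)) = (\<Sum>v\<in>V. f v)" for f :: "'a \<Rightarrow> real"
    using sum.reindex_bij_betw[OF bij_betw_nth[OF vs(1) refl refl]] vs(2) by simp
  have "trace_mat (?R * ?R) = (\<Sum>i<?n. \<Sum>j<?n. ?r (vs ! i) (vs ! j))"
    by (simp add: trace_mat_mult[OF randic_matrix_carrier randic_matrix_carrier] entry
             cong: sum.cong_simp)
  also have "\<dots> = (\<Sum>u\<in>V. \<Sum>v\<in>V. ?r u v)"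
    by (simp only: enum[of "?r _"] enum[of "\<lambda>u. \<Sum>v\<in>V. ?r u v"])
  also have "\<dots> = 2 * randic_index (2 * \<beta>) E"
    unfolding randic_index_def by (rule sum_over_adjacent_pairs[OF graph])
  finally show ?thesis .
qed

text \<open>Both ends of an edge have positive degree, so no base of a power is 0.\<close>

lemma randic_index_pos:
  assumes graph: "simple_graph V E" and edges: "card E \<ge> 1"
  shows "randic_index t E > 0"
proof -
  have finE: "finite E" and "E \<noteq> {}" using edges by (auto intro: card_ge_0_finite)
  moreover have "(\<Prod>v\<in>e. real (vdegree E v)) powr t > 0" if e: "e \<in> E" for e
  proof -
    have "vdegree E v > 0" if "v \<in> e" for v
      using finE e that by (auto simp: vdegree_def card_gt_0_iff)
    then have "(\<Prod>v\<in>e. real (vdegree E v)) > 0" by (intro prod_pos) simp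
    then show ?thesis by simp
  qed
  ultimately show ?thesis unfolding randic_index_def by (intro sum_pos)
qed

section \<open>Entropies of a multiset\<close>

lemma sum_abs_nonneg: "(\<Sum>x\<in>#M. \<bar>x\<bar> :: real) \<ge> 0"
  by (induction M) auto

text \<open>For a vanishing total both sides are 0, by the convention for division.\<close>

lemma sum_entropy_weight_powr:
  "(\<Sum>x\<in>#M. entropy_weight M x powr \<alpha>) = abs_moment \<alpha> M / (\<Sum>x\<in>#M. \<bar>x\<bar>) powr \<alpha>"
proof -
  have "entropy_weight M x powr \<alpha> = \<bar>x\<bar> powr \<alpha> * (1 / (\<Sum>x\<in>#M. \<bar>x\<bar>) powr \<alpha>)" for x
    by (simp add: entropy_weight_def powr_divide sum_abs_nonneg)
  then show ?thesis
    by (simp only: abs_moment_def flip: sum_mset_distrib_right) simp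
qed

lemma entropy1_eq:
  assumes S: "(\<Sum>x\<in>#M. \<bar>x\<bar>) \<noteq> 0"
  shows "entropy1 M = 1 - (\<Sum>x\<in>#M. x\<^sup>2) / (\<Sum>x\<in>#M. \<bar>x\<bar>)\<^sup>2"
proof -
  let ?S = "\<Sum>x\<in>#M. \<bar>x\<bar>"
  have summand: "\<bar>x\<bar> / c * (1 - \<bar>x\<bar> / c) = \<bar>x\<bar> / c - x\<^sup>2 / c\<^sup>2" for x c :: real
    by (simp add: algebra_simps power2_eq_square)
  have "(\<Sum>x\<in>#N. \<bar>x\<bar> / c * (1 - \<bar>x\<bar> / c)) = (\<Sum>x\<in>#N. \<bar>x\<bar>) / c - (\<Sum>x\<in>#N. x\<^sup>2) / c\<^sup>2"
    for N and c :: real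
    unfolding summand by (induction N) (simp_all add: add_divide_distrib)
  then show ?thesis using S by (simp add: entropy1_def entropy_weight_def)
qed

lemma sum_abs_nonzero:
  fixes M :: "real multiset"
  assumes "(\<Sum>x\<in>#M. x\<^sup>2) \<noteq> 0"
  shows "(\<Sum>x\<in>#M. \<bar>x\<bar>) \<noteq> 0"
proof
  assume "(\<Sum>x\<in>#M. \<bar>x\<bar>) = 0"
  then have "\<forall>x\<in>#M. x = 0"
    by (induction M) (auto simp: add_nonneg_eq_0_iff sum_abs_nonneg)
  then have "(\<Sum>x\<in>#M. x\<^sup>2) = 0" by (induction M) auto
  with assms show False ..
qed

theorem theorem3p15:
  fixes V :: "'a set" and E :: "'a set set" and vs :: "'a list"
    and \<beta> \<alpha> b :: real and \<gamma> :: "real multiset"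
  assumes graph: "simple_graph V E"
    and vertices: "distinct vs" "set vs = V"
    and edges: "card E \<ge> 1"
    and eigenvalues: "\<gamma> = eigenvalues_mset (randic_matrix \<beta> vs E)"
    and base: "b > 1"
    and alpha: "\<alpha> \<noteq> 1"
  shows "entropy1 \<gamma> = 1 - 2 / (randic_energy \<beta> vs E)\<^sup>2 * randic_index (2 * \<beta>) E
    \<and> entropy2 b \<alpha> \<gamma>
           = 1 / (1 - \<alpha>) * log b (abs_moment \<alpha> \<gamma> / randic_energy \<beta> vs E powr \<alpha>)
    \<and> entropy3 \<alpha> \<gamma>
           = 1 / (2 powr (1 - \<alpha>) - 1) * (abs_moment \<alpha> \<gamma> / randic_energy \<beta> vs E powr \<alpha> - 1)"
proof -
  have energy: "randic_energy \<beta> vs E = (\<Sum>x\<in>#\<gamma>. \<bar>x\<bar>)"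
    by (simp add: randic_energy_def eigenvalues)
  have squares: "(\<Sum>x\<in>#\<gamma>. x\<^sup>2) = 2 * randic_index (2 * \<beta>) E"
    unfolding eigenvalues
      trace_square_eigenvalues[OF randic_matrix_carrier randic_matrix_symmetric, symmetric]
    by (rule trace_square_randic_matrix[OF graph vertices])
  then have "(\<Sum>x\<in>#\<gamma>. \<bar>x\<bar>) \<noteq> 0"
    using randic_index_pos[OF graph edges, of "2 * \<beta>"] by (intro sum_abs_nonzero) simp
  then have "entropy1 \<gamma> = 1 - 2 / (randic_energy \<beta> vs E)\<^sup>2 * randic_index (2 * \<beta>) E"
    by (simp add: entropy1_eq energy squares)
  then show ?thesis
    by (simp add: entropy2_def entropy3_def sum_entropy_weight_powr energy)
qed

end
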